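(* Let $C=(c_{ij})$ and $C'=(c'_{ij})$ be real $n\times n$ matrices with row-sum vectors $(r_1,\ldots,r_n)$ and $(r'_1,\ldots,r'_n)$ respectively. Assume: (i) $c_{ij}\leq c'_{ij}$ for all $1\leq i\leq n$, $1\leq j\leq n-1$, and $r_i\leq r'_i$ for all $1\leq i\leq n$; (ii) $C'$ has a rooted eigenvector $v'=(v'_1,\ldots,v'_n)^T$ for an eigenvalue $\lambda'\in\mathbb{R}$; (iii) $C$ has a nonnegative left eigenvector $v^T=(v_1,\ldots,v_n)$ for an eigenvalue $\lambda\in\mathbb{R}$; (iv) $v^Tv'>0$. Then $\lambda\leq\lambda'$. Moreover, $\lambda=\lambda'$ if and only if both of the following hold: (a) if $v'_n\neq 0$, then $r_i=r'_i$ for all $1\le i\le n$ with $v_i\neq0$; (b) $c'_{ij}=c_{ij}$ for all $1\leq i\leq n$, $1\leq j\leq n-1$ with $v_i\neq 0$ and $v'_j>v'_n$.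
   Context: A real vector $(v_1,\ldots,v_n)$ is rooted if $v_i\geq v_n\geq 0$ for all $1\leq i\leq n-1$. The row-sum vector of a matrix is the vector of its row sums. *)

theory Defs
  imports "Jordan_Normal_Form.Char_Poly"
begin

text \<open>Vectors and matrices are indexed from 0, so the last entry of a vector \<open>v\<close> of
  dimension \<open>n\<close> is \<open>v $ (n - 1)\<close>.\<close>

definition rooted :: "real vec \<Rightarrow> bool" where
  "rooted v \<longleftrightarrow> 0 < dim_vec v
     \<and> (\<forall>i < dim_vec v - 1. v $ (dim_vec v - 1) \<le> v $ i)
     \<and> 0 \<le> v $ (dim_vec v - 1)"

definition row_sum_vec :: "real mat \<Rightarrow> real vec" where
  "row_sum_vec A = vec (dim_row A) (\<lambda>i. \<Sum>j < dim_col A. A $$ (i, j))"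

definition left_eigenvector :: "real mat \<Rightarrow> real vec \<Rightarrow> real \<Rightarrow> bool" where
  "left_eigenvector A v k \<longleftrightarrow> v \<in> carrier_vec (dim_row A) \<and> v \<noteq> 0\<^sub>v (dim_row A)
     \<and> mat_of_row v * A = k \<cdot>\<^sub>m mat_of_row v"

lemma left_eigenvector_transpose:
  assumes "A \<in> carrier_mat n n"
  shows "left_eigenvector A v k \<longleftrightarrow> eigenvector (transpose_mat A) v k"
proof -
  have "mat_of_row v * A = k \<cdot>\<^sub>m mat_of_row v \<longleftrightarrow> transpose_mat A *\<^sub>v v = k \<cdot>\<^sub>v v"
    if v: "v \<in> carrier_vec n"
  proof -
    have "mat_of_row v * A = k \<cdot>\<^sub>m mat_of_row v \<longleftrightarrow> (\<forall>j<n. v \<bullet> col A j = k * v $ j)"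
      using assms v by (auto simp: mat_eq_iff)
    also have "\<dots> \<longleftrightarrow> (\<forall>j<n. col A j \<bullet> v = k * v $ j)"
      using assms v by (metis carrier_matD(1) col_dim comm_scalar_prod)
    also have "\<dots> \<longleftrightarrow> transpose_mat A *\<^sub>v v = k \<cdot>\<^sub>v v"
      using assms v by (auto simp: vec_eq_iff)
    finally show ?thesis .
  qed
  then show ?thesis
    using assms by (auto simp: left_eigenvector_def eigenvector_def)
qed

end

theory Submission
  imports Defs
begin

text \<open>Put \<open>D = C' - C\<close>. Pairing \<open>C' v' = l' v'\<close> with \<open>v\<close> and \<open>v\<^sup>T C = l v\<^sup>T\<close> with \<open>v'\<close> gives
  \<open>(l' - l) (v \<bullet> v') = v \<bullet> (D v')\<close>. Writing \<open>v'\<close> as its last entry times the all-ones vector plus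
  a nonnegative remainder that vanishes in the last coordinate shows that each entry of \<open>D v'\<close> is a
  sum of nonnegative terms, one for the row sum and one for each column but the last. So
  \<open>v \<bullet> (D v') \<ge> 0\<close>, and it is \<open>0\<close> iff all these terms vanish in every row \<open>i\<close> with \<open>v\<^sub>i \<noteq> 0\<close>.\<close>

lemma scalar_prod_nonneg:
  fixes u v :: "'a :: ordered_semiring_0 vec"
  assumes "v \<in> carrier_vec n" and "\<And>i. i < n \<Longrightarrow> 0 \<le> u $ i" and "\<And>i. i < n \<Longrightarrow> 0 \<le> v $ i"
  shows "0 \<le> u \<bullet> v"
  using assms by (auto simp: scalar_prod_def intro!: sum_nonneg mult_nonneg_nonneg)

lemma scalar_prod_nonneg_eq_0_iff:
  fixes u v :: "'a :: {ordered_semiring_0, semiring_no_zero_divisors} vec"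
  assumes "v \<in> carrier_vec n" and "\<And>i. i < n \<Longrightarrow> 0 \<le> u $ i" and "\<And>i. i < n \<Longrightarrow> 0 \<le> v $ i"
  shows "u \<bullet> v = 0 \<longleftrightarrow> (\<forall>i<n. u $ i \<noteq> 0 \<longrightarrow> v $ i = 0)"
proof -
  have "u \<bullet> v = 0 \<longleftrightarrow> (\<forall>i\<in>{0..<n}. u $ i * v $ i = 0)"
    using assms unfolding scalar_prod_def by (subst sum_nonneg_eq_0_iff) auto
  then show ?thesis
    by auto
qed

lemma eigenvalue_diff_scalar_prod:
  fixes A B :: "'a :: comm_ring_1 mat"
  assumes A: "A \<in> carrier_mat n n" and B: "B \<in> carrier_mat n n"
    and v: "eigenvector (transpose_mat A) v k" and w: "eigenvector B w m"
  shows "(m - k) * (v \<bullet> w) = v \<bullet> ((B - A) *\<^sub>v w)"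
proof -
  have v_dim: "v \<in> carrier_vec n" and w_dim: "w \<in> carrier_vec n"
    using v w A B by (auto simp: eigenvector_def)
  have "v \<bullet> (B *\<^sub>v w) = m * (v \<bullet> w)"
    using w v_dim w_dim by (simp add: eigenvector_def)
  moreover have "v \<bullet> (A *\<^sub>v w) = k * (v \<bullet> w)"
    using transpose_vec_mult_scalar[OF A w_dim v_dim] v v_dim w_dim by (simp add: eigenvector_def)
  moreover have "v \<bullet> ((B - A) *\<^sub>v w) = v \<bullet> (B *\<^sub>v w) - v \<bullet> (A *\<^sub>v w)"
    using A B v_dim w_dim
    by (simp add: minus_mult_distrib_mat_vec[OF B A] scalar_prod_minus_distrib[of _ n])
  ultimately show ?thesis
    by (simp add: left_diff_distrib)
qed

lemma row_sum_vec_minus: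
  assumes "A \<in> carrier_mat m n" and "B \<in> carrier_mat m n"
  shows "row_sum_vec (A - B) = row_sum_vec A - row_sum_vec B"
  using assms by (auto simp: row_sum_vec_def sum_subtractf)

lemma mult_mat_vec_split_last:
  assumes "A \<in> carrier_mat m n" and "w \<in> carrier_vec n" and "0 < n" and "i < m"
  shows "(A *\<^sub>v w) $ i =
    (\<Sum>j<n-1. A $$ (i, j) * (w $ j - w $ (n-1))) + w $ (n-1) * row_sum_vec A $ i"
proof -
  obtain k where n: "n = Suc k"
    using \<open>0 < n\<close> gr0_conv_Suc by blast
  have "(A *\<^sub>v w) $ i = (\<Sum>j<n. A $$ (i, j) * w $ j)"
    using assms by (auto simp: scalar_prod_def lessThan_atLeast0)
  moreover have "row_sum_vec A $ i = (\<Sum>j<n. A $$ (i, j))"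
    using assms by (simp add: row_sum_vec_def)
  ultimately show ?thesis
    by (simp add: n algebra_simps sum_subtractf sum_distrib_left)
qed

lemma
  assumes A: "A \<in> carrier_mat m n" and w: "w \<in> carrier_vec n" "rooted w" and i: "i < m"
    and entries_nonneg: "\<And>j. j < n-1 \<Longrightarrow> 0 \<le> A $$ (i, j)"
    and row_sum_nonneg: "0 \<le> row_sum_vec A $ i"
  shows mult_mat_vec_rooted_nonneg: "0 \<le> (A *\<^sub>v w) $ i"
    and mult_mat_vec_rooted_eq_0_iff: "(A *\<^sub>v w) $ i = 0 \<longleftrightarrow>
      (w $ (n-1) \<noteq> 0 \<longrightarrow> row_sum_vec A $ i = 0) \<and>
      (\<forall>j<n-1. w $ j > w $ (n-1) \<longrightarrow> A $$ (i, j) = 0)"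
      (is "?zero \<longleftrightarrow> ?terms_zero")
proof -
  let ?term = "\<lambda>j. A $$ (i, j) * (w $ j - w $ (n-1))"
  have "0 < n" and last_nonneg: "0 \<le> w $ (n-1)"
    and last_le: "\<And>j. j < n-1 \<Longrightarrow> w $ (n-1) \<le> w $ j"
    using w by (auto simp: rooted_def)
  have split: "(A *\<^sub>v w) $ i = sum ?term {..<n-1} + w $ (n-1) * row_sum_vec A $ i"
    using A w(1) \<open>0 < n\<close> i by (rule mult_mat_vec_split_last)
  have term_nonneg: "0 \<le> ?term j" if "j \<in> {..<n-1}" for j
    using that entries_nonneg last_le by simp
  then have terms_nonneg: "0 \<le> sum ?term {..<n-1}"
    by (rule sum_nonneg)
  have last_term_nonneg: "0 \<le> w $ (n-1) * row_sum_vec A $ i"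
    using last_nonneg row_sum_nonneg by simp
  show "0 \<le> (A *\<^sub>v w) $ i"
    unfolding split using terms_nonneg last_term_nonneg by simp
  have "?term j = 0 \<longleftrightarrow> (w $ j > w $ (n-1) \<longrightarrow> A $$ (i, j) = 0)" if "j < n-1" for j
    using last_le[OF that] by auto
  then have "sum ?term {..<n-1} = 0 \<longleftrightarrow> (\<forall>j<n-1. w $ j > w $ (n-1) \<longrightarrow> A $$ (i, j) = 0)"
    using sum_nonneg_eq_0_iff[OF finite_lessThan term_nonneg] by auto
  then show "?zero \<longleftrightarrow> ?terms_zero"
    unfolding split add_nonneg_eq_0_iff[OF terms_nonneg last_term_nonneg] by auto
qed

lemma
  assumes A: "A \<in> carrier_mat m n" and w: "w \<in> carrier_vec n" "rooted w"
    and entries_nonneg: "\<And>i j. i < m \<Longrightarrow> j < n-1 \<Longrightarrow> 0 \<le> A $$ (i, j)"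
    and row_sums_nonneg: "\<And>i. i < m \<Longrightarrow> 0 \<le> row_sum_vec A $ i"
    and v_nonneg: "\<And>i. i < m \<Longrightarrow> 0 \<le> v $ i"
  shows scalar_prod_mult_rooted_nonneg: "0 \<le> v \<bullet> (A *\<^sub>v w)"
    and scalar_prod_mult_rooted_eq_0_iff: "v \<bullet> (A *\<^sub>v w) = 0 \<longleftrightarrow>
      (w $ (n-1) \<noteq> 0 \<longrightarrow> (\<forall>i<m. v $ i \<noteq> 0 \<longrightarrow> row_sum_vec A $ i = 0)) \<and>
      (\<forall>i<m. \<forall>j<n-1. v $ i \<noteq> 0 \<and> w $ j > w $ (n-1) \<longrightarrow> A $$ (i, j) = 0)"
      (is "?zero \<longleftrightarrow> ?terms_zero")
proof -
  have Aw: "A *\<^sub>v w \<in> carrier_vec m"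
    using A w(1) by (rule mult_mat_vec_carrier)
  have Aw_nonneg: "0 \<le> (A *\<^sub>v w) $ i" if "i < m" for i
    using A w that entries_nonneg row_sums_nonneg by (intro mult_mat_vec_rooted_nonneg)
  show "0 \<le> v \<bullet> (A *\<^sub>v w)"
    using Aw v_nonneg Aw_nonneg by (rule scalar_prod_nonneg)
  have "v \<bullet> (A *\<^sub>v w) = 0 \<longleftrightarrow> (\<forall>i<m. v $ i \<noteq> 0 \<longrightarrow> (A *\<^sub>v w) $ i = 0)"
    using Aw v_nonneg Aw_nonneg by (rule scalar_prod_nonneg_eq_0_iff)
  moreover have "(A *\<^sub>v w) $ i = 0 \<longleftrightarrow> (w $ (n-1) \<noteq> 0 \<longrightarrow> row_sum_vec A $ i = 0) \<and>
      (\<forall>j<n-1. w $ j > w $ (n-1) \<longrightarrow> A $$ (i, j) = 0)" if "i < m" for i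
    using A w that entries_nonneg row_sums_nonneg by (intro mult_mat_vec_rooted_eq_0_iff)
  ultimately show "?zero \<longleftrightarrow> ?terms_zero"
    by blast
qed

theorem theorem3p4:
  fixes n :: nat and C C' :: "real mat" and r r' v v' :: "real vec" and l l' :: real
  assumes n: "1 \<le> n"
    and C: "C \<in> carrier_mat n n" and C': "C' \<in> carrier_mat n n"
    and r: "r = row_sum_vec C" and r': "r' = row_sum_vec C'"
    and entries_le: "\<forall>i<n. \<forall>j<n-1. C $$ (i, j) \<le> C' $$ (i, j)"
    and row_sums_le: "\<forall>i<n. r $ i \<le> r' $ i"
    and v'_eigen: "eigenvector C' v' l'" and v'_rooted: "rooted v'"
    and v_eigen: "left_eigenvector C v l" and v_nonneg: "\<forall>i<n. 0 \<le> v $ i"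
    and vv'_pos: "v \<bullet> v' > 0"
  shows "l \<le> l' \<and>
    (l = l' \<longleftrightarrow>
      (v' $ (n-1) \<noteq> 0 \<longrightarrow> (\<forall>i<n. v $ i \<noteq> 0 \<longrightarrow> r $ i = r' $ i)) \<and>
      (\<forall>i<n. \<forall>j<n-1. v $ i \<noteq> 0 \<and> v' $ j > v' $ (n-1) \<longrightarrow> C' $$ (i, j) = C $$ (i, j)))"
proof -
  let ?D = "C' - C"
  have D: "?D \<in> carrier_mat n n" and v': "v' \<in> carrier_vec n"
    using C C' v'_eigen by (auto simp: eigenvector_def)
  have D_entry: "?D $$ (i, j) = C' $$ (i, j) - C $$ (i, j)" if "i < n" "j < n-1" for i j
    using C C' that by simp
  have D_row_sum: "row_sum_vec ?D $ i = r' $ i - r $ i" if "i < n" for i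
    unfolding r r' row_sum_vec_minus[OF C' C] using C that by (simp add: row_sum_vec_def)
  have pairing: "(l' - l) * (v \<bullet> v') = v \<bullet> (?D *\<^sub>v v')"
    using C C' v_eigen v'_eigen
    by (intro eigenvalue_diff_scalar_prod) (simp_all add: left_eigenvector_transpose)
  have "0 \<le> v \<bullet> (?D *\<^sub>v v')"
    using entries_le row_sums_le v_nonneg
    by (intro scalar_prod_mult_rooted_nonneg[OF D v' v'_rooted]) (simp_all add: D_entry D_row_sum)
  then have "l \<le> l'"
    using vv'_pos by (simp add: pairing[symmetric] zero_le_mult_iff)
  moreover have "l = l' \<longleftrightarrow> v \<bullet> (?D *\<^sub>v v') = 0"
    using vv'_pos by (auto simp: pairing[symmetric])
  ultimately show ?thesis
    using entries_le row_sums_le v_nonneg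
    by (subst (asm) scalar_prod_mult_rooted_eq_0_iff[OF D v' v'_rooted])
       (auto simp: D_entry D_row_sum)
qed

end
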